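(* Let $p=(v_1,\dots,v_n)$ be a convex polygon in $H^2$ and let $U$ be a non-trivial isometric first-order deformation of $p$. Then $b(U)\in(\mathbb{R}_+\setminus\{0\})\,\mathrm{int}(p^* )$, i.e. $b(U)$ is in the positive cone over the interior of the dual polygon $p^*$; that is, $\langle b(U),v_i\rangle>0$ for all $i\in\{1,\dots,n\}$.
   Context: $\mathbb{R}^3_1$ is $\mathbb{R}^3$ with the bilinear form $\langle(x,y,z),(x',y',z')\rangle=xx'+yy'-zz'$, and $H^2=\{u=(x,y,z)\in\mathbb{R}^3_1:\langle u,u\rangle=-1,\ z>0\}$ is the hyperbolic plane. A hyperbolic polygon with $n\ge3$ vertices is a finite sequence $p=(v_1,\dots,v_n)$ of points of $H^2$ with $v_i\neq v_{i+1}$ (indices modulo $n$); its edges are the geodesic segments $[v_i,v_{i+1}]$. It is convex if it is the boundary of a convex domain of $H^2$, with all interior angles in $(0,\pi)$; $\alpha_i$ is then the interior angle at $v_i$. The dual polygon $p^*$ is defined as in the sphere by the duality for the Minkowski scalar product, and the positive cone over its interior is $\{x\in\mathbb{R}^3_1:\langle x,v_i\rangle>0\ \text{for all } i\}$. A first-order deformation $U$ of $p$ is given by vectors $\dot v_i=dv_i(U)\in T_{v_i}H^2$; it is isometric if $\langle\dot v_i,v_{i+1}\rangle+\langle v_i,\dot v_{i+1}\rangle=0$ for all $i$, and trivial if $(\dot v_i)$ is the restriction to the vertices of a Killing field of $H^2$ (an element of the Lie algebra $so(2,1)$). Let $d\alpha_i(U)$ be the corresponding first-order variation of $\alpha_i$.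 The quadratic invariant $b$ is $$b(U)=\sum_{i=1}^n d\alpha_i(U)\,dv_i(U)\in\mathbb{R}^3_1;$$ it does not change when a trivial deformation is added to $U$. *)

theory Defs
  imports "HOL-Analysis.Analysis"
begin

definition mink :: "real^3 \<Rightarrow> real^3 \<Rightarrow> real" where
  "mink u w = u$1 * w$1 + u$2 * w$2 - u$3 * w$3"

definition H2 :: "(real^3) set" where
  "H2 = {u. mink u u = -1 \<and> u$3 > 0}"

definition tangent_H2 :: "real^3 \<Rightarrow> (real^3) set" where
  "tangent_H2 u = {w. mink w u = 0}"

text \<open>Only used for spacelike vectors (tangent vectors of the hyperbolic plane).\<close>

definition mink_norm :: "real^3 \<Rightarrow> real" where
  "mink_norm w = sqrt (mink w w)"

text \<open>Geodesics are the intersections of the hyperbolic plane with linear planes, so the segment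
  between two points is cut out by the linear cone that they span.\<close>

definition geod_segment :: "real^3 \<Rightarrow> real^3 \<Rightarrow> (real^3) set" where
  "geod_segment x y = {z \<in> H2. \<exists>a\<ge>0. \<exists>b\<ge>0. z = a *\<^sub>R x + b *\<^sub>R y}"

text \<open>The geodesic with initial point \<open>u\<close> and initial velocity \<open>w\<close>, at time \<open>t\<close>;
  for \<open>w = 0\<close> it is constant, since division by zero gives zero.\<close>

definition geodesic :: "real^3 \<Rightarrow> real^3 \<Rightarrow> real \<Rightarrow> real^3" where
  "geodesic u w t = cosh (t * mink_norm w) *\<^sub>R u + (sinh (t * mink_norm w) / mink_norm w) *\<^sub>R w"

text \<open>A tangent vector at \<open>v\<close> pointing along the geodesic from \<open>v\<close> to \<open>u\<close>:
  the orthogonal projection of \<open>u\<close> to the tangent plane at \<open>v\<close>.\<close>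

definition direction :: "real^3 \<Rightarrow> real^3 \<Rightarrow> real^3" where
  "direction v u = u + mink u v *\<^sub>R v"

definition hyp_angle :: "real^3 \<Rightarrow> real^3 \<Rightarrow> real^3 \<Rightarrow> real" where
  "hyp_angle u v w =
     arccos (mink (direction v u) (direction v w) /
             (mink_norm (direction v u) * mink_norm (direction v w)))"

text \<open>A polygon with \<open>n\<close> vertices is a map \<open>v\<close> of which only the values at the indices
  below \<open>n\<close> are used; indices are cyclic.\<close>

definition next_idx :: "nat \<Rightarrow> nat \<Rightarrow> nat" where
  "next_idx n i = Suc i mod n"

definition prev_idx :: "nat \<Rightarrow> nat \<Rightarrow> nat" where
  "prev_idx n i = (i + n - 1) mod n"

definition hyp_polygon :: "nat \<Rightarrow> (nat \<Rightarrow> real^3) \<Rightarrow> bool" where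
  "hyp_polygon n v \<longleftrightarrow> n \<ge> 3 \<and> (\<forall>i<n. v i \<in> H2 \<and> v i \<noteq> v (next_idx n i))"

definition edge :: "nat \<Rightarrow> (nat \<Rightarrow> real^3) \<Rightarrow> nat \<Rightarrow> (real^3) set" where
  "edge n v i = geod_segment (v i) (v (next_idx n i))"

definition convex_domain_H2 :: "(real^3) set \<Rightarrow> bool" where
  "convex_domain_H2 D \<longleftrightarrow> D \<noteq> {} \<and> openin (top_of_set H2) D \<and>
     (\<forall>x\<in>D. \<forall>y\<in>D. geod_segment x y \<subseteq> D)"

text \<open>The closed curve formed by the edges is simple: distinct edges meet at most in common
  endpoints.\<close>

definition simple_polygon :: "nat \<Rightarrow> (nat \<Rightarrow> real^3) \<Rightarrow> bool" where
  "simple_polygon n v \<longleftrightarrow> inj_on v {..<n} \<and>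
     (\<forall>i<n. \<forall>j<n. i \<noteq> j \<longrightarrow>
        edge n v i \<inter> edge n v j \<subseteq> {v i, v (next_idx n i)} \<inter> {v j, v (next_idx n j)})"

text \<open>The angle of a convex domain at a boundary vertex is at most \<open>\<pi>\<close>, so the interior angle
  is the unoriented angle between the two adjacent edges.  This stays true for nearby polygons
  as long as all angles of the initial one lie strictly between \<open>0\<close> and \<open>\<pi>\<close>.\<close>

definition interior_angle :: "nat \<Rightarrow> (nat \<Rightarrow> real^3) \<Rightarrow> nat \<Rightarrow> real" where
  "interior_angle n v i = hyp_angle (v (prev_idx n i)) (v i) (v (next_idx n i))"

text \<open>Being the boundary of a domain is understood for the polygon as a closed curve, which
  therefore runs exactly once around the domain; hence the requirement that it be simple.
  (As a set of points alone, a polygon run around twice would have the same boundary.)\<close>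

definition convex_polygon :: "nat \<Rightarrow> (nat \<Rightarrow> real^3) \<Rightarrow> bool" where
  "convex_polygon n v \<longleftrightarrow> hyp_polygon n v \<and> simple_polygon n v \<and>
     (\<exists>D. convex_domain_H2 D \<and> (top_of_set H2) frontier_of D = (\<Union>i<n. edge n v i)) \<and>
     (\<forall>i<n. 0 < interior_angle n v i \<and> interior_angle n v i < pi)"

text \<open>A deformation is given by the velocities \<open>v'\<close> of the vertices.\<close>

definition first_order_deformation ::
    "nat \<Rightarrow> (nat \<Rightarrow> real^3) \<Rightarrow> (nat \<Rightarrow> real^3) \<Rightarrow> bool" where
  "first_order_deformation n v v' \<longleftrightarrow> (\<forall>i<n. v' i \<in> tangent_H2 (v i))"

definition isometric_deformation ::
    "nat \<Rightarrow> (nat \<Rightarrow> real^3) \<Rightarrow> (nat \<Rightarrow> real^3) \<Rightarrow> bool" where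
  "isometric_deformation n v v' \<longleftrightarrow> first_order_deformation n v v' \<and>
     (\<forall>i<n. mink (v' i) (v (next_idx n i)) + mink (v i) (v' (next_idx n i)) = 0)"

definition so21 :: "(real^3^3) set" where
  "so21 = {A. \<forall>x y. mink (A *v x) y + mink x (A *v y) = 0}"

text \<open>The Killing fields of the hyperbolic plane are the restrictions of the linear vector fields
  given by the elements of the Lie algebra.\<close>

definition trivial_deformation ::
    "nat \<Rightarrow> (nat \<Rightarrow> real^3) \<Rightarrow> (nat \<Rightarrow> real^3) \<Rightarrow> bool" where
  "trivial_deformation n v v' \<longleftrightarrow> (\<exists>A\<in>so21. \<forall>i<n. v' i = A *v v i)"

text \<open>The derivative of the angle along the variation that moves each vertex on the geodesic with
  the prescribed velocity.  Where the angle lies strictly between \<open>0\<close> and \<open>\<pi>\<close> it is a smooth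
  function of the vertices, so every other variation with these velocities gives the same value.\<close>

definition d_angle :: "nat \<Rightarrow> (nat \<Rightarrow> real^3) \<Rightarrow> (nat \<Rightarrow> real^3) \<Rightarrow> nat \<Rightarrow> real" where
  "d_angle n v v' i = deriv (\<lambda>t. interior_angle n (\<lambda>j. geodesic (v j) (v' j) t) i) 0"

definition quadratic_invariant :: "nat \<Rightarrow> (nat \<Rightarrow> real^3) \<Rightarrow> (nat \<Rightarrow> real^3) \<Rightarrow> real^3" where
  "quadratic_invariant n v v' = (\<Sum>i<n. d_angle n v v' i *\<^sub>R v' i)"

text \<open>The positive cone over the interior of the dual polygon.\<close>

definition dual_interior_cone :: "nat \<Rightarrow> (nat \<Rightarrow> real^3) \<Rightarrow> (real^3) set" where
  "dual_interior_cone n v = {x. \<forall>i<n. mink x (v i) > 0}"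

end

theory Submission
  imports Defs
begin

text \<open>Each edge moves by a Killing field \<open>K i\<close>, and the fields of two consecutive edges differ by the
  infinitesimal rotation about their common vertex, by minus the variation of the angle there.
  Hence the product of the invariant with a vertex \<open>W 0\<close> is a quadratic form in the angle variations
  whose coefficients are determinants of \<open>W 0\<close> with two other vertices.  Projecting along \<open>W 0\<close> to a
  plane, the remaining vertices have increasing slopes \<open>t 1 < t 2 < \<dots>\<close>, and up to scaling the form is
  \<open>- \<Sum>i<j. c i * c j * (t j - t i)\<close> with \<open>\<Sum>i. c i = 0\<close>, which is
  \<open>\<Sum>i. C i ^ 2 * (t (i + 1) - t i)\<close> for the partial sums \<open>C\<close> of \<open>c\<close>.\<close>

section \<open>Minkowski space\<close>

text \<open>The determinant: its sign is the orientation of the triple, and it is zero exactly for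
  linearly dependent vectors.\<close>

definition triple :: "real^3 \<Rightarrow> real^3 \<Rightarrow> real^3 \<Rightarrow> real" where
  "triple x y z = x$1 * (y$2 * z$3 - y$3 * z$2) + x$2 * (y$3 * z$1 - y$1 * z$3)
     + x$3 * (y$1 * z$2 - y$2 * z$1)"

text \<open>The Lorentz cross product identifies the Lie algebra \<open>so21\<close> with the space itself:
  \<open>lcross K\<close> is the Killing field of \<open>K\<close>.\<close>

definition lcross :: "real^3 \<Rightarrow> real^3 \<Rightarrow> real^3" where
  "lcross x y = vector [x$2 * y$3 - x$3 * y$2, x$3 * y$1 - x$1 * y$3, x$2 * y$1 - x$1 * y$2]"

lemma lcross_nth [simp]:
  "lcross x y $ 1 = x$2 * y$3 - x$3 * y$2"
  "lcross x y $ 2 = x$3 * y$1 - x$1 * y$3"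
  "lcross x y $ 3 = x$2 * y$1 - x$1 * y$2"
  by (simp_all add: lcross_def)

text \<open>\<open>lcross\<close> is the Euclidean cross product with its third coordinate negated,
  which cancels the sign in \<open>mink\<close>; so the mixed product is the ordinary
  determinant.\<close>

lemma mink_lcross: "mink (lcross x y) z = triple x y z"
  and mink_lcross_right: "mink z (lcross x y) = triple x y z"
  by (simp_all add: mink_def triple_def algebra_simps)

lemma lcross_lcross: "lcross x (lcross y z) = mink x y *\<^sub>R z - mink x z *\<^sub>R y"
  by (simp add: vec_eq_iff forall_3 mink_def algebra_simps)

lemma lcross_diff_left: "lcross (x - y) z = lcross x z - lcross y z"
  and lcross_add_left: "lcross (x + y) z = lcross x z + lcross y z"
  and lcross_scale_left: "lcross (c *\<^sub>R x) z = c *\<^sub>R lcross x z"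
  and lcross_anticomm: "lcross x z = - lcross z x"
  by (simp_all add: vec_eq_iff forall_3 algebra_simps)

lemma lcross_self [simp]: "lcross x x = 0"
  by (simp add: vec_eq_iff forall_3)

lemma mink_commute: "mink x y = mink y x"
  and mink_add_left: "mink (x + y) z = mink x z + mink y z"
  and mink_diff_left: "mink (x - y) z = mink x z - mink y z"
  and mink_scale_left: "mink (c *\<^sub>R x) z = c * mink x z"
  and mink_add_right: "mink z (x + y) = mink z x + mink z y"
  and mink_diff_right: "mink z (x - y) = mink z x - mink z y"
  and mink_scale_right: "mink z (c *\<^sub>R x) = c * mink z x"
  by (simp_all add: mink_def algebra_simps)

lemmas mink_linear = mink_add_left mink_diff_left mink_scale_left
  mink_add_right mink_diff_right mink_scale_right

lemma mink_sum_left: "mink (\<Sum>i\<in>A. f i) z = (\<Sum>i\<in>A. mink (f i) z)"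
  by (induction A rule: infinite_finite_induct) (simp_all add: mink_linear, simp_all add: mink_def)

lemma triple_rotate: "triple x y z = triple y z x"
  and triple_swap: "triple x y z = - triple y x z"
  and triple_self [simp]: "triple x x z = 0" "triple x z x = 0" "triple z x x = 0"
  by (simp_all add: triple_def algebra_simps)

lemma triple_add3: "triple x y (a + b) = triple x y a + triple x y b"
  and triple_scale3: "triple x y (c *\<^sub>R a) = c * triple x y a"
  by (simp_all add: triple_def algebra_simps)

lemma mink_lcross_lcross:
  "mink (lcross a b) (lcross c d) = mink a d * mink b c - mink a c * mink b d"
proof -
  have "mink (lcross a b) (lcross c d) = mink (lcross b (lcross c d)) a"
    unfolding mink_lcross by (rule triple_rotate)
  thus ?thesis
    by (simp add: lcross_lcross mink_linear mink_commute[of _ a] algebra_simps)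
qed

text \<open>The three-term Pluecker relation. The vectors \<open>lcross w p\<close> and
  \<open>lcross w x\<close> are orthogonal to \<open>w\<close>, so their cross product is a multiple
  of \<open>w\<close>; its product with \<open>lcross q y\<close> is expanded in two ways.\<close>

lemma triple_pluecker:
  "triple w p q * triple w x y = triple w x q * triple w p y - triple w p x * triple w y q"
proof -
  have eq: "lcross (lcross w p) (lcross w x) = (- triple w p x) *\<^sub>R w"
    by (simp add: lcross_lcross mink_lcross)
  have "mink (lcross q y) (lcross (lcross w p) (lcross w x)) = - triple w p x * triple w q y"
    unfolding eq mink_scale_right mink_lcross triple_rotate[of w q y] ..
  hence "triple w x q * triple w p y - triple w p q * triple w x y
      = - triple w p x * triple w q y"
    unfolding mink_lcross_lcross unfolding mink_lcross mink_lcross_right .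
  moreover have sw: "triple w q y = - triple w y q"
    by (simp add: triple_def algebra_simps)
  ultimately show ?thesis
    unfolding sw by linarith
qed

text \<open>The right side is minus the Gram determinant, since the Minkowski form has determinant
  -1.\<close>

lemma triple_sq:
  "(triple u v w)\<^sup>2 = - (mink u u * mink v v * mink w w) - 2 * mink u v * mink v w * mink u w
     + mink u u * (mink v w)\<^sup>2 + mink v v * (mink u w)\<^sup>2 + mink w w * (mink u v)\<^sup>2"
  unfolding triple_def mink_def by algebra

section \<open>Inequalities for points and tangent vectors of the hyperbolic plane\<close>

text \<open>The reversed Cauchy-Schwarz inequality; it is strict because the excess contains the
  squared differences of the first two coordinates, which determine a point of
  \<open>H2\<close>.\<close>

lemma mink_lt_minus_one:
  assumes "x \<in> H2" "y \<in> H2" "x \<noteq> y"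
  shows "mink x y < -1"
proof -
  have x: "(x$3)\<^sup>2 = 1 + (x$1)\<^sup>2 + (x$2)\<^sup>2" "x$3 > 0"
    and y: "(y$3)\<^sup>2 = 1 + (y$1)\<^sup>2 + (y$2)\<^sup>2" "y$3 > 0"
    using assms by (auto simp: H2_def mink_def power2_eq_square)
  have ne: "x$1 \<noteq> y$1 \<or> x$2 \<noteq> y$2"
  proof (rule ccontr)
    assume "\<not> ?thesis"
    moreover from this have "(x$3)\<^sup>2 = (y$3)\<^sup>2"
      using x y by simp
    hence "x$3 = y$3"
      using x(2) y(2) by (metis less_imp_le power2_eq_imp_eq)
    ultimately show False
      using assms by (simp add: vec_eq_iff forall_3)
  qed
  have "(x$3 * y$3)\<^sup>2 = (1 + (x$1)\<^sup>2 + (x$2)\<^sup>2) * (1 + (y$1)\<^sup>2 + (y$2)\<^sup>2)"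
    using x y by (simp add: power_mult_distrib)
  also have "\<dots> = (1 + (x$1 * y$1 + x$2 * y$2))\<^sup>2 + (x$1 - y$1)\<^sup>2 + (x$2 - y$2)\<^sup>2
      + (x$1 * y$2 - x$2 * y$1)\<^sup>2"
    by (simp add: power2_eq_square algebra_simps)
  also have "\<dots> > (1 + (x$1 * y$1 + x$2 * y$2))\<^sup>2"
  proof -
    have "(x$1 - y$1)\<^sup>2 + (x$2 - y$2)\<^sup>2 > 0"
      using ne by (auto simp: sum_power2_gt_zero_iff)
    thus ?thesis
      using zero_le_power2[of "x$1 * y$2 - x$2 * y$1"] by linarith
  qed
  finally have "1 + (x$1 * y$1 + x$2 * y$2) < x$3 * y$3"
    using x y power2_less_imp_less[of "1 + (x$1 * y$1 + x$2 * y$2)" "x$3 * y$3"] by simp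
  thus ?thesis
    by (simp add: mink_def)
qed

text \<open>Tangency expresses \<open>w$3 * u$3\<close> by the other coordinates; after
  multiplication by \<open>(u$3)\<^sup>2\<close> the form is a sum of squares.\<close>

lemma tangent_spacelike:
  assumes "u \<in> H2" "w \<in> tangent_H2 u"
  shows "mink w w \<ge> 0" "mink w w = 0 \<Longrightarrow> w = 0"
proof -
  have u: "(u$3)\<^sup>2 = 1 + (u$1)\<^sup>2 + (u$2)\<^sup>2" "u$3 > 0"
    using assms by (auto simp: H2_def mink_def power2_eq_square)
  have w: "w$3 * u$3 = w$1 * u$1 + w$2 * u$2"
    using assms by (auto simp: tangent_H2_def mink_def)
  have "(u$3)\<^sup>2 * mink w w = (u$3)\<^sup>2 * ((w$1)\<^sup>2 + (w$2)\<^sup>2) - (w$3 * u$3)\<^sup>2"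
    by (simp add: mink_def power2_eq_square algebra_simps)
  also have "\<dots> = (w$1)\<^sup>2 + (w$2)\<^sup>2 + (w$1 * u$2 - w$2 * u$1)\<^sup>2"
    unfolding u(1) w by (simp add: power2_eq_square algebra_simps)
  finally have eq: "(u$3)\<^sup>2 * mink w w = (w$1)\<^sup>2 + (w$2)\<^sup>2 + (w$1 * u$2 - w$2 * u$1)\<^sup>2" .
  have "0 \<le> (u$3)\<^sup>2 * mink w w"
    unfolding eq by simp
  thus "mink w w \<ge> 0"
    using u(2) by (simp add: zero_le_mult_iff)
  assume "mink w w = 0"
  hence "(w$1)\<^sup>2 + (w$2)\<^sup>2 + (w$1 * u$2 - w$2 * u$1)\<^sup>2 = 0"
    using eq by simp
  hence "w$1 = 0" "w$2 = 0"
    by (simp_all add: add_nonneg_eq_0_iff)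
  moreover from this have "w$3 = 0"
    using w u(2) by simp
  ultimately show "w = 0"
    by (simp add: vec_eq_iff forall_3)
qed

section \<open>Lines, planes and their normals\<close>

text \<open>The double product \<open>lcross v (lcross v d)\<close> is minus the projection of
  \<open>d\<close> to the orthogonal plane of \<open>v\<close>.\<close>

lemma parallel_if_lcross_zero:
  assumes "mink v v = -1" "lcross d v = 0"
  shows "d = (- mink v d) *\<^sub>R v"
proof -
  have "lcross v (lcross v d) = 0"
    using assms(2) by (subst (2) lcross_anticomm) (simp add: vec_eq_iff forall_3)
  hence "- d - mink v d *\<^sub>R v = 0"
    unfolding lcross_lcross assms(1) by simp
  thus ?thesis
    unfolding vec_eq_iff forall_3 by simp
qed

text \<open>The squared norm is \<open>(mink x y)\<^sup>2 - 1\<close>; solving for coefficients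
  along or across the plane of \<open>x\<close> and \<open>y\<close> divides by it.\<close>

lemma lcross_norm_pos:
  assumes "x \<in> H2" "y \<in> H2" "x \<noteq> y"
  shows "mink (lcross x y) (lcross x y) > 0"
proof -
  have "(mink x y)\<^sup>2 > 1"
    unfolding power2_gt_1_iff using mink_lt_minus_one[OF assms] by simp
  moreover have "mink (lcross x y) (lcross x y) = (mink x y)\<^sup>2 - mink x x * mink y y"
    unfolding mink_lcross_lcross by (simp add: mink_commute[of y x] power2_eq_square)
  ultimately show ?thesis
    using assms by (simp add: H2_def)
qed

text \<open>The double product gives \<open>lcross d m = 0\<close>, and expanding
  \<open>lcross m (lcross d m)\<close> then makes \<open>d\<close> a multiple of the normal
  \<open>m\<close>.\<close>

lemma orthogonal_complement_pair:
  assumes "x \<in> H2" "y \<in> H2" "x \<noteq> y" "mink d x = 0" "mink d y = 0"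
  obtains \<kappa> where "d = \<kappa> *\<^sub>R lcross x y"
proof -
  define m where "m = lcross x y"
  have "mink m m > 0"
    unfolding m_def by (rule lcross_norm_pos) fact+
  have "lcross d m = 0"
    unfolding m_def lcross_lcross by (simp add: assms)
  hence md: "mink m d *\<^sub>R m = mink m m *\<^sub>R d"
    using lcross_lcross[of m d m] by (simp add: vec_eq_iff forall_3)
  have "d = inverse (mink m m) *\<^sub>R (mink m m *\<^sub>R d)"
    using \<open>mink m m > 0\<close> by simp
  also have "\<dots> = (mink m d / mink m m) *\<^sub>R lcross x y"
    unfolding md[symmetric] by (simp add: m_def divide_inverse_commute)
  finally show ?thesis
    using that by blast
qed

text \<open>As \<open>z\<close> is orthogonal to the normal \<open>m\<close>, applying
  \<open>lcross m\<close> twice multiplies it by \<open>mink m m\<close>, while every image of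
  \<open>lcross m\<close> lies in the span of \<open>x\<close> and \<open>y\<close>.\<close>

lemma coplanar_combination:
  assumes "x \<in> H2" "y \<in> H2" "x \<noteq> y" "triple x y z = 0"
  obtains a b where "z = a *\<^sub>R x + b *\<^sub>R y"
proof -
  define m where "m = lcross x y"
  have "mink m m > 0"
    unfolding m_def by (rule lcross_norm_pos) fact+
  have eq: "lcross m u = mink u y *\<^sub>R x - mink u x *\<^sub>R y" for u
    unfolding m_def by (subst lcross_anticomm) (simp add: lcross_lcross)
  have "mink m m *\<^sub>R z = lcross m (lcross m z)"
    unfolding lcross_lcross using assms(4) by (simp add: m_def mink_lcross)
  also have "\<dots> = (mink (lcross m z) y) *\<^sub>R x + (- mink (lcross m z) x) *\<^sub>R y"
    unfolding eq[of "lcross m z"] by simp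
  finally have "inverse (mink m m) *\<^sub>R (mink m m *\<^sub>R z)
      = inverse (mink m m) *\<^sub>R ((mink (lcross m z) y) *\<^sub>R x + (- mink (lcross m z) x) *\<^sub>R y)"
    by (rule arg_cong)
  hence "z = (inverse (mink m m) * mink (lcross m z) y) *\<^sub>R x
      + (inverse (mink m m) * - mink (lcross m z) x) *\<^sub>R y"
    using \<open>mink m m > 0\<close> by (simp add: scaleR_diff_right)
  thus ?thesis
    by (rule that)
qed

section \<open>Killing fields\<close>

text \<open>The field of \<open>lcross v v'\<close> is right at \<open>v\<close>. Its error at
  \<open>w\<close> is orthogonal to \<open>w\<close> by tangency and to \<open>v\<close> by
  isometry, so it is a multiple of \<open>lcross v w\<close>, which a rotation about
  \<open>v\<close> corrects.\<close>

lemma edge_killing_field: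
  assumes "v \<in> H2" "w \<in> H2" "v \<noteq> w"
    and "mink v' v = 0" "mink w' w = 0" "mink v' w + mink v w' = 0"
  obtains K where "lcross K v = v'" "lcross K w = w'"
proof -
  define K where "K = lcross v v'"
  define d where "d = w' - lcross K w"
  have vv: "mink v v = -1"
    using assms by (auto simp: H2_def)
  have Kv: "lcross K v = v'"
    unfolding K_def
    by (subst lcross_anticomm, subst lcross_lcross)
      (use assms vv in \<open>simp add: mink_commute\<close>)
  have dv: "mink d v = 0"
  proof -
    have "mink d v = mink w' v - triple K w v"
      by (simp add: d_def mink_linear mink_lcross)
    also have "triple K w v = - mink (lcross K v) w"
      unfolding mink_lcross by (simp add: triple_def algebra_simps)
    finally show ?thesis
      using assms(6) by (simp add: Kv mink_commute)
  qed
  have dw: "mink d w = 0"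
    using assms(5) by (simp add: d_def mink_linear mink_lcross)
  obtain \<kappa> where \<kappa>: "d = \<kappa> *\<^sub>R lcross v w"
    using orthogonal_complement_pair[OF assms(1-3) dv dw] .
  have d: "\<kappa> *\<^sub>R lcross v w = w' - lcross K w"
    using \<kappa> unfolding d_def by (rule sym)
  show ?thesis
  proof
    show "lcross (K + \<kappa> *\<^sub>R v) v = v'"
      by (simp add: lcross_add_left lcross_scale_left Kv)
    show "lcross (K + \<kappa> *\<^sub>R v) w = w'"
      by (simp add: lcross_add_left lcross_scale_left d)
  qed
qed

lemma killing_deformation_trivial:
  assumes "\<And>i. i < n \<Longrightarrow> v' i = lcross K (v i)"
  shows "trivial_deformation n v v'"
proof -
  have "linear (lcross K)"
    by (rule linearI) (simp_all add: vec_eq_iff forall_3 algebra_simps)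
  hence A: "matrix (lcross K) *v x = lcross K x" for x
    by (metis matrix_vector_mul)
  have "mink (lcross K x) y + mink x (lcross K y) = 0" for x y
    by (simp add: mink_def algebra_simps)
  hence "matrix (lcross K) \<in> so21"
    by (simp add: so21_def A)
  thus ?thesis
    unfolding trivial_deformation_def using assms A by metis
qed

section \<open>Variation of the angles\<close>

text \<open>This makes the angle formula of \<open>hyp_angle_eq\<close> valid at all times, so that
  it may be differentiated.\<close>

lemma mink_geodesic_self:
  assumes "u \<in> H2" "w \<in> tangent_H2 u"
  shows "mink (geodesic u w t) (geodesic u w t) = -1"
proof (cases "mink w w = 0")
  case True
  then show ?thesis
    using tangent_spacelike[OF assms] assms by (simp add: geodesic_def mink_norm_def H2_def mink_linear)
next
  case False
  hence pos: "mink w w > 0"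
    using tangent_spacelike(1)[OF assms] by simp
  define N where "N = mink_norm w"
  have N: "N\<^sup>2 = mink w w" "N \<noteq> 0"
    using pos by (auto simp: N_def mink_norm_def)
  have "mink u u = -1" "mink w u = 0" "mink u w = 0"
    using assms by (auto simp: H2_def tangent_H2_def mink_commute)
  hence "mink (geodesic u w t) (geodesic u w t)
      = (sinh (t * N))\<^sup>2 / N\<^sup>2 * mink w w - (cosh (t * N))\<^sup>2"
    unfolding geodesic_def N_def[symmetric]
    by (simp add: mink_linear power2_eq_square)
  also have "\<dots> = (sinh (t * N))\<^sup>2 - (cosh (t * N))\<^sup>2"
    using N pos by simp
  also have "\<dots> = -1"
    by (simp add: cosh_square_eq)
  finally show ?thesis .
qed

lemma geodesic_0 [simp]: "geodesic u w 0 = u"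
  by (simp add: geodesic_def)

lemma geodesic_nth_derivative:
  assumes "u \<in> H2" "w \<in> tangent_H2 u"
  shows "((\<lambda>t. geodesic u w t $ i) has_real_derivative w $ i) (at 0)"
proof (cases "mink w w = 0")
  case True
  then show ?thesis
    using tangent_spacelike[OF assms] by (simp add: geodesic_def mink_norm_def)
next
  case False
  define N where "N = mink_norm w"
  have "N \<noteq> 0"
    using False by (simp add: N_def mink_norm_def)
  thus ?thesis
    unfolding geodesic_def N_def[symmetric] by (auto intro!: derivative_eq_intros)
qed

lemma mink_geodesic_derivative:
  assumes "u \<in> H2" "u' \<in> tangent_H2 u" "w \<in> H2" "w' \<in> tangent_H2 w"
  shows "((\<lambda>t. mink (geodesic u u' t) (geodesic w w' t)) has_real_derivative
           mink u' w + mink u w') (at 0)"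
proof -
  have "((\<lambda>t. geodesic u u' t $ i * geodesic w w' t $ i) has_real_derivative
      u' $ i * w $ i + w' $ i * u $ i) (at 0)" for i
    using DERIV_mult[OF geodesic_nth_derivative[OF assms(1,2), of i]
        geodesic_nth_derivative[OF assms(3,4), of i]]
    unfolding geodesic_0 .
  note d = this
  have "mink u' w + mink u w' = (u' $ 1 * w $ 1 + w' $ 1 * u $ 1) + (u' $ 2 * w $ 2 + w' $ 2 * u $ 2)
      - (u' $ 3 * w $ 3 + w' $ 3 * u $ 3)"
    by (simp add: mink_def algebra_simps)
  moreover have "((\<lambda>t. mink (geodesic u u' t) (geodesic w w' t)) has_real_derivative
      (u' $ 1 * w $ 1 + w' $ 1 * u $ 1) + (u' $ 2 * w $ 2 + w' $ 2 * u $ 2)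
      - (u' $ 3 * w $ 3 + w' $ 3 * u $ 3)) (at 0)"
    unfolding mink_def by (intro DERIV_diff DERIV_add d)
  ultimately show ?thesis
    by metis
qed

text \<open>The hyperbolic law of cosines: on \<open>H2\<close>, \<open>- mink\<close> is the
  hyperbolic cosine of the distance, and the square roots are hyperbolic sines.\<close>

lemma hyp_angle_eq:
  assumes "mink u u = -1" "mink v v = -1" "mink w w = -1"
  shows "hyp_angle u v w = arccos ((mink u w + mink u v * mink v w) /
           (sqrt ((mink u v)\<^sup>2 - 1) * sqrt ((mink v w)\<^sup>2 - 1)))"
proof -
  have c: "mink v u = mink u v" "mink w v = mink v w" "mink w u = mink u w"
    by (rule mink_commute)+
  have "mink (direction v u) (direction v w) = mink u w + mink u v * mink v w"
    "mink (direction v u) (direction v u) = (mink u v)\<^sup>2 - 1"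
    "mink (direction v w) (direction v w) = (mink v w)\<^sup>2 - 1"
    unfolding direction_def by (simp_all add: mink_linear assms c power2_eq_square)
  thus ?thesis
    by (simp add: hyp_angle_def mink_norm_def)
qed

text \<open>Isometry keeps the two side lengths fixed to first order, so only
  \<open>mink u w\<close> contributes. The Gram determinant identifies the factor from
  \<open>arccos\<close> and the sides with \<open>\<bar>triple u v w\<bar>\<close>, and the strict
  bounds on the angle make \<open>arccos\<close> differentiable.\<close>

lemma hyp_angle_derivative:
  assumes H: "u \<in> H2" "v \<in> H2" "w \<in> H2"
    and T: "u' \<in> tangent_H2 u" "v' \<in> tangent_H2 v" "w' \<in> tangent_H2 w"
    and ne: "u \<noteq> v" "v \<noteq> w"
    and iso: "mink u' v + mink u v' = 0" "mink v' w + mink v w' = 0"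
    and ang: "0 < hyp_angle u v w" "hyp_angle u v w < pi"
  shows "triple u v w \<noteq> 0"
    and "deriv (\<lambda>t. hyp_angle (geodesic u u' t) (geodesic v v' t) (geodesic w w' t)) 0
         = - (mink u' w + mink u w') / \<bar>triple u v w\<bar>"
proof -
  have self: "mink u u = -1" "mink v v = -1" "mink w w = -1"
    using H by (auto simp: H2_def)
  define P where "P = mink u v"
  define Q where "Q = mink v w"
  define R where "R = mink u w"
  have P: "P\<^sup>2 > 1" and Q: "Q\<^sup>2 > 1"
    unfolding P_def Q_def power2_gt_1_iff
    using mink_lt_minus_one[OF H(1,2) ne(1)] mink_lt_minus_one[OF H(2,3) ne(2)] by auto
  define s where "s = sqrt (P\<^sup>2 - 1) * sqrt (Q\<^sup>2 - 1)"
  have s: "s > 0" "s\<^sup>2 = (P\<^sup>2 - 1) * (Q\<^sup>2 - 1)"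
    using P Q by (auto simp: s_def power_mult_distrib)
  define f where "f = (R + P * Q) / s"
  have tri: "(triple u v w)\<^sup>2 = s\<^sup>2 - (R + P * Q)\<^sup>2"
    unfolding triple_sq self s P_def[symmetric] Q_def[symmetric] R_def[symmetric]
    by (simp add: power2_eq_square algebra_simps)
  also have "\<dots> = s\<^sup>2 * (1 - f\<^sup>2)"
    using s(1) by (simp add: f_def field_simps)
  finally have tri_f: "(triple u v w)\<^sup>2 = s\<^sup>2 * (1 - f\<^sup>2)" .
  \<comment> \<open>That \<open>f\<close> is a genuine cosine is read off from a square, before
    anything is known about \<open>arccos f\<close>.\<close>
  have "0 \<le> s\<^sup>2 * (1 - f\<^sup>2)"
    using tri_f by (metis zero_le_power2)
  hence "f\<^sup>2 \<le> 1"
    using s(1) by (simp add: zero_le_mult_iff)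
  hence "\<bar>f\<bar> \<le> 1"
    by (simp add: abs_square_le_1)
  moreover have "hyp_angle u v w = arccos f"
    unfolding hyp_angle_eq[OF self] f_def s_def P_def Q_def R_def by simp
  hence "f \<noteq> 1" "f \<noteq> -1"
    using ang by auto
  ultimately have f: "-1 < f" "f < 1"
    by auto
  hence "f\<^sup>2 < 1"
    by (simp add: abs_square_less_1)
  hence tri_s: "\<bar>triple u v w\<bar> = s * sqrt (1 - f\<^sup>2)"
    using s(1) arg_cong[OF tri_f, of sqrt] by (simp add: real_sqrt_mult)
  with \<open>f\<^sup>2 < 1\<close> s(1) show "triple u v w \<noteq> 0"
    by auto
  define p where "p t = mink (geodesic u u' t) (geodesic v v' t)" for t
  define q where "q t = mink (geodesic v v' t) (geodesic w w' t)" for t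
  define r where "r t = mink (geodesic u u' t) (geodesic w w' t)" for t
  have [simp]: "p 0 = P" "q 0 = Q" "r 0 = R"
    by (simp_all add: p_def q_def r_def P_def Q_def R_def)
  have p: "(p has_real_derivative 0) (at 0)" and q: "(q has_real_derivative 0) (at 0)"
    and r: "(r has_real_derivative mink u' w + mink u w') (at 0)"
    unfolding p_def q_def r_def
    using mink_geodesic_derivative[OF H(1) T(1) H(2) T(2)]
      mink_geodesic_derivative[OF H(2) T(2) H(3) T(3)]
      mink_geodesic_derivative[OF H(1) T(1) H(3) T(3)] iso by simp_all
  define S where "S t = sqrt ((p t)\<^sup>2 - 1) * sqrt ((q t)\<^sup>2 - 1)" for t
  have [simp]: "S 0 = s"
    by (simp add: S_def s_def)
  have "((\<lambda>t. sqrt ((h t)\<^sup>2 - 1)) has_real_derivative 0) (at 0)"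
    if "(h has_real_derivative 0) (at 0)" "(h 0)\<^sup>2 > 1" for h
  proof -
    have "((\<lambda>t. (h t)\<^sup>2 - 1) has_real_derivative 0) (at 0)"
      by (rule DERIV_cong[OF DERIV_diff[OF DERIV_power[OF that(1)] DERIV_const]]) simp
    moreover have "(sqrt has_real_derivative inverse (sqrt ((h 0)\<^sup>2 - 1)) / 2) (at ((h 0)\<^sup>2 - 1))"
      by (rule DERIV_real_sqrt) (use that(2) in simp)
    ultimately show ?thesis
      using DERIV_chain2[where f=sqrt and g="\<lambda>t. (h t)\<^sup>2 - 1" and x=0 and Db=0] by fastforce
  qed
  from DERIV_mult[OF this[OF p] this[OF q]] P Q have S: "(S has_real_derivative 0) (at 0)"
    unfolding S_def by simp
  have "((\<lambda>t. r t + p t * q t) has_real_derivative mink u' w + mink u w') (at 0)"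
    by (rule DERIV_cong[OF DERIV_add[OF r DERIV_mult[OF p q]]]) simp
  note DERIV_divide[OF this S]
  hence "((\<lambda>t. (r t + p t * q t) / S t) has_real_derivative
      (mink u' w + mink u w') / s) (at 0)"
    using s(1) by (simp add: divide_simps)
  moreover have "(arccos has_real_derivative inverse (- sqrt (1 - f\<^sup>2)))
      (at ((r 0 + p 0 * q 0) / S 0))"
    using DERIV_arccos[OF f] by (simp add: f_def)
  ultimately have "((\<lambda>t. arccos ((r t + p t * q t) / S t)) has_real_derivative
      inverse (- sqrt (1 - f\<^sup>2)) * ((mink u' w + mink u w') / s)) (at 0)"
    by (intro DERIV_chain2)
  moreover have "(\<lambda>t. hyp_angle (geodesic u u' t) (geodesic v v' t) (geodesic w w' t))
      = (\<lambda>t. arccos ((r t + p t * q t) / S t))"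
    using H T by (simp add: hyp_angle_eq mink_geodesic_self p_def q_def r_def S_def)
  ultimately show "deriv (\<lambda>t. hyp_angle (geodesic u u' t) (geodesic v v' t) (geodesic w w' t)) 0
      = - (mink u' w + mink u w') / \<bar>triple u v w\<bar>"
    unfolding tri_s by (simp add: DERIV_imp_deriv divide_simps)
qed

section \<open>The quadratic form\<close>

text \<open>Summation by parts. The boundary terms serve the induction; they vanish when
  \<open>\<Lambda>\<close> and \<open>Y\<close> return to their initial values at \<open>m\<close>,
  which leaves weighted squares.\<close>

lemma abel_sum:
  fixes \<Lambda> Y t :: "nat \<Rightarrow> real"
  assumes "\<forall>i<m. Y (Suc i) - Y i = (\<Lambda> (Suc i) - \<Lambda> i) * t (Suc i)"
  shows "(\<Sum>i<m. (\<Lambda> i - \<Lambda> (Suc i)) * (\<Lambda> (Suc i) * t (Suc i) - Y (Suc i)))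
    = (\<Sum>i<m. (\<Lambda> i - \<Lambda> 0)\<^sup>2 * (t (Suc i) - t i)) + (\<Lambda> m - \<Lambda> 0) * (Y m - Y 0)
      - (\<Lambda> m - \<Lambda> 0)\<^sup>2 * t m - \<Lambda> 0 * (Y m - Y 0) + Y 0 * (\<Lambda> m - \<Lambda> 0)"
  using assms
proof (induction m)
  case (Suc m)
  have Y: "Y m = Y (Suc m) - (\<Lambda> (Suc m) - \<Lambda> m) * t (Suc m)"
    using Suc.prems by (simp add: algebra_simps)
  have "\<forall>i<m. Y (Suc i) - Y i = (\<Lambda> (Suc i) - \<Lambda> i) * t (Suc i)"
    using Suc.prems by simp
  note IH = Suc.IH[OF this]
  show ?case
    unfolding sum.lessThan_Suc IH unfolding Y by (simp add: power2_eq_square algebra_simps)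
qed simp

text \<open>Modulo the line of \<open>W 0\<close>, the other points lie in an open half-plane \<open>l > 0\<close>, and convexity
  says that their slopes \<open>t = y / l\<close> increase.  Summation by parts then turns the sum into
  squares weighted by the increments of the slopes.\<close>

lemma quadratic_sum_pos:
  fixes W K :: "nat \<Rightarrow> real^3" and c :: "nat \<Rightarrow> real"
  assumes n: "n \<ge> 3"
    and step: "\<And>i. K (Suc i) = K i - c (Suc i) *\<^sub>R W (Suc i)"
    and per: "K n = K 0" "W n = W 0"
    and unit: "\<sigma> * \<sigma> = 1"
    and first: "\<And>j. 2 \<le> j \<Longrightarrow> j < n \<Longrightarrow> \<sigma> * triple (W 0) (W 1) (W j) > 0"
    and last: "\<And>j. 1 \<le> j \<Longrightarrow> j < n - 1 \<Longrightarrow> \<sigma> * triple (W 0) (W j) (W (n - 1)) > 0"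
    and mid: "\<And>j. 1 \<le> j \<Longrightarrow> j < n - 1 \<Longrightarrow> \<sigma> * triple (W 0) (W j) (W (Suc j)) > 0"
    and nontriv: "i0 < n" "K i0 \<noteq> K 0"
  shows "(\<Sum>i<n. c i * (\<sigma> * triple (K i) (W i) (W 0))) > 0"
proof -
  define m where "m = n - 1"
  have m: "n = Suc m" "m \<ge> 2"
    using n by (auto simp: m_def)
  define T where "T x y z = \<sigma> * triple x y z" for x y z
  \<comment> \<open>Up to the factor \<open>D\<close>, \<open>x\<close> and \<open>y\<close> are the
    coordinates along \<open>W 1\<close> and \<open>W m\<close> modulo \<open>W 0\<close>; their sum
    \<open>l\<close> will be positive on all \<open>W i\<close> with
    \<open>1 \<le> i \<le> m\<close>.\<close>
  define x where "x a = T (W 0) a (W m)" for a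
  define y where "y a = T (W 0) (W 1) a" for a
  define l where "l a = x a + y a" for a
  define D where "D = T (W 0) (W 1) (W m)"
  define t where "t i = y (W i) / l (W i)" for i
  define \<Lambda> where "\<Lambda> i = l (K i)" for i
  define Y where "Y i = y (K i)" for i
  have T_self: "T a a b = 0" "T a b b = 0" "T a b a = 0" for a b
    by (simp_all add: T_def)
  have D: "D > 0"
    using first[of m] m by (simp add: D_def T_def)
  have unit': "(\<sigma> * a) * (\<sigma> * b) = a * b" for a b
  proof -
    have "(\<sigma> * a) * (\<sigma> * b) = (\<sigma> * \<sigma>) * (a * b)"
      by (simp add: ac_simps)
    thus ?thesis
      by (simp add: unit)
  qed
  have pl: "D * T (W 0) a b = x a * y b - y a * x b" for a b
    unfolding D_def x_def y_def T_def unit' by (rule triple_pluecker)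
  have lpos: "l (W i) > 0" if "1 \<le> i" "i \<le> m" for i
  proof -
    have "x (W i) \<ge> 0" "y (W i) \<ge> 0"
      unfolding x_def y_def using first[of i] last[of i] that m
      by (cases "i = m"; cases "i = 1"; simp add: T_def less_imp_le)+
    moreover have "x (W i) > 0 \<or> y (W i) > 0"
      unfolding x_def y_def using first[of i] last[of i] that m
      by (cases "i = m") (simp_all add: T_def)
    ultimately show ?thesis
      by (auto simp: l_def)
  qed
  have lin: "y (a - r *\<^sub>R b) = y a - r * y b" "l (a - r *\<^sub>R b) = l a - r * l b" for a b r
    by (simp_all add: l_def x_def y_def T_def triple_def algebra_simps)
  have \<Lambda>: "\<Lambda> i - \<Lambda> (Suc i) = c (Suc i) * l (W (Suc i))" for i
    by (simp add: \<Lambda>_def step lin)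
  have t: "y (W i) = t i * l (W i)" if "1 \<le> i" "i \<le> m" for i
    using lpos[OF that] by (simp add: t_def)
  \<comment> \<open>\<open>K\<close> moves along \<open>W (Suc i)\<close>, so the increment of
    \<open>(\<Lambda>, Y)\<close> has slope \<open>t (Suc i)\<close>.\<close>
  have Y: "Y (Suc i) - Y i = (\<Lambda> (Suc i) - \<Lambda> i) * t (Suc i)" if "i < m" for i
    using \<Lambda>[of i] t[of "Suc i"] that by (simp add: Y_def step lin algebra_simps)
  have tinc: "t (Suc i) > t i" if "1 \<le> i" "i < m" for i
  proof -
    have "0 < D * T (W 0) (W i) (W (Suc i))"
      using D mid[of i] that m by (simp add: T_def)
    also have "\<dots> = l (W i) * y (W (Suc i)) - y (W i) * l (W (Suc i))"
      unfolding pl by (simp add: l_def algebra_simps)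
    also have "\<dots> = l (W i) * l (W (Suc i)) * (t (Suc i) - t i)"
      using t[of i] t[of "Suc i"] that by (simp add: algebra_simps)
    finally have "0 < l (W i) * l (W (Suc i)) * (t (Suc i) - t i)" .
    from zero_less_mult_pos[OF this mult_pos_pos[OF lpos[of i] lpos[of "Suc i"]]] that
    show ?thesis
      by simp
  qed
  have W0: "x (W 0) = 0" "y (W 0) = 0" "l (W 0) = 0"
    by (simp_all add: l_def x_def y_def T_self)
  \<comment> \<open>The last step is along \<open>W n = W 0\<close>, on which \<open>l\<close> and
    \<open>y\<close> vanish, so \<open>\<Lambda>\<close> and \<open>Y\<close> close up already at
    \<open>m = n - 1\<close>.\<close>
  have "K 0 = K m - c n *\<^sub>R W 0"
    using step[of m] per m by simp
  hence "K m = K 0 + c n *\<^sub>R W 0"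
    by simp
  hence fin: "\<Lambda> m = \<Lambda> 0" "Y m = Y 0"
    using lin[of "K 0" "- c n" "W 0"] by (simp_all add: \<Lambda>_def Y_def W0)
  have "D * (\<Sum>i<n. c i * T (K i) (W i) (W 0)) = (\<Sum>i<n. c i * (D * T (W 0) (K i) (W i)))"
    by (simp add: sum_distrib_left T_def triple_rotate[of "W 0"] algebra_simps)
  also have "\<dots> = (\<Sum>i<m. c (Suc i) * (D * T (W 0) (K (Suc i)) (W (Suc i))))"
    unfolding m(1) by (subst sum.lessThan_Suc_shift) (simp add: T_self)
  also have "\<dots> = (\<Sum>i<m. (\<Lambda> i - \<Lambda> (Suc i)) * (\<Lambda> (Suc i) * t (Suc i) - Y (Suc i)))"
  proof (intro sum.cong refl)
    fix i assume "i \<in> {..<m}"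
    hence i: "1 \<le> Suc i" "Suc i \<le> m"
      by auto
    have "D * T (W 0) (K (Suc i)) (W (Suc i)) = \<Lambda> (Suc i) * y (W (Suc i)) - Y (Suc i) * l (W (Suc i))"
      unfolding pl by (simp add: \<Lambda>_def Y_def l_def algebra_simps)
    also have "\<dots> = l (W (Suc i)) * (\<Lambda> (Suc i) * t (Suc i) - Y (Suc i))"
      using t[OF i] by (simp add: algebra_simps)
    finally show "c (Suc i) * (D * T (W 0) (K (Suc i)) (W (Suc i)))
        = (\<Lambda> i - \<Lambda> (Suc i)) * (\<Lambda> (Suc i) * t (Suc i) - Y (Suc i))"
      by (simp add: \<Lambda>)
  qed
  also have "\<dots> = (\<Sum>i<m. (\<Lambda> i - \<Lambda> 0)\<^sup>2 * (t (Suc i) - t i))"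
    by (subst abel_sum) (auto simp: Y fin)
  also have "\<dots> > 0"
  proof -
    \<comment> \<open>If \<open>\<Lambda>\<close> were constant, positivity of \<open>l\<close>
      would make \<open>c i\<close> zero for \<open>1 \<le> i \<le> m\<close>, and \<open>K\<close>
      would be constant.\<close>
    have "\<exists>i<m. \<Lambda> i \<noteq> \<Lambda> 0"
    proof (rule ccontr)
      assume "\<not> ?thesis"
      hence const: "\<Lambda> i = \<Lambda> 0" if "i \<le> m" for i
        using that fin le_neq_implies_less by blast
      have "i \<le> m \<Longrightarrow> K i = K 0" for i
      proof (induction i)
        case (Suc i)
        have "c (Suc i) = 0"
          using \<Lambda>[of i] const[of i] const[of "Suc i"] lpos[of "Suc i"] Suc.prems by simp
        with Suc show ?case
          by (simp add: step)
      qed simp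
      with nontriv m(1) show False
        using less_Suc_eq_le by blast
    qed
    then obtain i where i: "i < m" "\<Lambda> i \<noteq> \<Lambda> 0"
      by blast
    hence "i \<ge> 1"
      by (cases i) auto
    show ?thesis
    proof (rule sum_pos2[of _ i])
      show "0 < (\<Lambda> i - \<Lambda> 0)\<^sup>2 * (t (Suc i) - t i)"
        using i tinc[OF \<open>i \<ge> 1\<close>] by simp
      \<comment> \<open>At \<open>j = 0\<close> the slope \<open>t 0\<close> is a division by zero,
        but the square in front of it is zero.\<close>
      show "0 \<le> (\<Lambda> j - \<Lambda> 0)\<^sup>2 * (t (Suc j) - t j)" if "j \<in> {..<m}" for j
        using tinc[of j] that by (cases "j = 0") auto
    qed (use i in auto)
  qed
  finally show ?thesis
    using D by (simp add: zero_less_mult_iff T_def)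
qed

section \<open>Convex polygons\<close>

lemma geod_segment_endpoints:
  assumes "x \<in> H2" "y \<in> H2"
  shows "x \<in> geod_segment x y" "y \<in> geod_segment x y"
proof -
  have "x = 1 *\<^sub>R x + 0 *\<^sub>R y" "y = 0 *\<^sub>R x + 1 *\<^sub>R y" and le: "(0::real) \<le> 1" "(0::real) \<le> 0"
    by simp_all
  thus "x \<in> geod_segment x y" "y \<in> geod_segment x y"
    unfolding geod_segment_def using assms le by blast+
qed

text \<open>By the reversed Cauchy-Schwarz inequality the combination has squared norm at most
  \<open>- (a + b)\<^sup>2\<close>, so it can be scaled into \<open>H2\<close>. This links geodesic
  convexity with linear convexity of cones.\<close>

lemma geod_segment_cone:
  assumes "x \<in> H2" "y \<in> H2" "a \<ge> 0" "b \<ge> 0" "a + b > 0"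
  obtains r z where "r > 0" "z \<in> geod_segment x y" "a *\<^sub>R x + b *\<^sub>R y = r *\<^sub>R z"
proof -
  define w where "w = a *\<^sub>R x + b *\<^sub>R y"
  have self: "mink x x = -1" "mink y y = -1" and pos: "x$3 > 0" "y$3 > 0"
    using assms by (auto simp: H2_def)
  have "mink x y \<le> -1"
    using mink_lt_minus_one[OF assms(1,2)] self by (cases "x = y") auto
  hence "a * b * mink x y \<le> a * b * (-1)"
    using assms by (intro mult_left_mono) auto
  moreover have "mink w w = 2 * (a * b * mink x y) - a\<^sup>2 - b\<^sup>2"
    by (simp add: w_def mink_linear self mink_commute[of y x] power2_eq_square algebra_simps)
  ultimately have "mink w w \<le> - (a + b)\<^sup>2"
    by (simp add: power2_sum)
  moreover have "(a + b)\<^sup>2 > 0"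
    using assms(5) by simp
  ultimately have neg: "mink w w < 0"
    by linarith
  define r where "r = sqrt (- mink w w)"
  have r: "r > 0" "r\<^sup>2 = - mink w w"
    using neg by (auto simp: r_def)
  define z where "z = inverse r *\<^sub>R w"
  have "mink z z = inverse (r\<^sup>2) * mink w w"
    by (simp add: z_def mink_linear power2_eq_square)
  also have "\<dots> = -1"
    using neg unfolding r(2) by simp
  finally have "mink z z = -1" .
  moreover have "w$3 > 0"
  proof (cases "a > 0")
    case True
    then show ?thesis
      using assms pos by (simp add: w_def add_pos_nonneg)
  next
    case False
    then show ?thesis
      using assms pos by (simp add: w_def)
  qed
  ultimately have "z \<in> H2"
    using r by (simp add: H2_def z_def)
  moreover have "z = (inverse r * a) *\<^sub>R x + (inverse r * b) *\<^sub>R y"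
    by (simp add: z_def w_def scaleR_add_right)
  moreover have "inverse r * a \<ge> 0" "inverse r * b \<ge> 0"
    using assms r by simp_all
  ultimately have "z \<in> geod_segment x y"
    unfolding geod_segment_def by blast
  moreover have "a *\<^sub>R x + b *\<^sub>R y = r *\<^sub>R z"
    unfolding w_def[symmetric] using r(1) by (simp add: z_def)
  ultimately show ?thesis
    by (rule that[OF r(1)])
qed

text \<open>Equal norms leave \<open>r = 1\<close> or \<open>r = -1\<close>, and the positive third
  coordinates exclude the latter.\<close>

lemma H2_scale_eq:
  assumes "x \<in> H2" "y \<in> H2" "x = r *\<^sub>R y"
  shows "x = y"
proof -
  have "r * r = 1" "r * y$3 > 0" "y$3 > 0"
    using assms by (auto simp: H2_def mink_linear)
  hence "r > 0" "r * r = 1"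
    by (auto simp: zero_less_mult_iff)
  hence "r = 1"
    using power2_eq_imp_eq[of r 1] by (simp add: power2_eq_square)
  thus ?thesis
    using assms by simp
qed

section \<open>Supporting planes and convex position\<close>

text \<open>A supporting plane at an interior point of a boundary segment contains both endpoints,
  hence it is the plane spanned by the segment.\<close>

lemma boundary_segment_supporting:
  assumes D: "convex_domain_H2 D"
    and xy: "x \<in> H2" "y \<in> H2" "x \<noteq> y"
    and seg: "geod_segment x y \<subseteq> top_of_set H2 frontier_of D"
  obtains c where "c \<noteq> 0" "\<And>z. z \<in> top_of_set H2 frontier_of D \<Longrightarrow> c * triple x y z \<ge> 0"
proof -
  let ?F = "top_of_set H2 frontier_of D"
  have op: "openin (top_of_set H2) D" and ne: "D \<noteq> {}"
    and conv: "\<And>p q. p \<in> D \<Longrightarrow> q \<in> D \<Longrightarrow> geod_segment p q \<subseteq> D"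
    using D by (auto simp: convex_domain_H2_def)
  have DH: "D \<subseteq> H2"
    using op by (metis openin_imp_subset)
  have F: "?F = top_of_set H2 closure_of D - D"
    unfolding frontier_of_def using op by (simp add: interior_of_openin)
  have Fcl: "?F \<subseteq> closure D"
    using F closure_of_subtopology_subset[of euclidean H2 D] by auto
  \<comment> \<open>\<open>m\<close> is the midpoint of the segment, the interior point at which a
    supporting plane is taken.\<close>
  obtain r m where rm: "r > 0" "m \<in> geod_segment x y" "1 *\<^sub>R x + 1 *\<^sub>R y = r *\<^sub>R m"
    using geod_segment_cone[OF xy(1,2), of 1 1] by auto
  have mF: "m \<in> ?F" and mH: "m \<in> H2"
    using seg rm by (auto simp: geod_segment_def)
  \<comment> \<open>The cone over \<open>D\<close> is convex in the linear sense and misses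
    \<open>m\<close>, so the separation theorem applies.\<close>
  define S where "S = {\<nu> *\<^sub>R d | \<nu> d. \<nu> > 0 \<and> d \<in> D}"
  have "convex S"
  proof (rule convexI)
    fix p q and s t :: real
    assume pq: "p \<in> S" "q \<in> S" and st: "0 \<le> s" "0 \<le> t" "s + t = 1"
    from pq obtain \<nu> d \<mu> e where e: "p = \<nu> *\<^sub>R d" "q = \<mu> *\<^sub>R e" "\<nu> > 0" "\<mu> > 0" "d \<in> D" "e \<in> D"
      unfolding S_def by auto
    have "0 < s * \<nu> + t * \<mu>"
      using st e by (cases "s = 0") (auto intro!: add_pos_nonneg)
    then obtain \<rho> f where f: "\<rho> > 0" "f \<in> geod_segment d e" "(s * \<nu>) *\<^sub>R d + (t * \<mu>) *\<^sub>R e = \<rho> *\<^sub>R f"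
      using geod_segment_cone[of d e "s * \<nu>" "t * \<mu>"] DH e st by auto
    have "f \<in> D"
      using f(2) conv e by blast
    moreover have "s *\<^sub>R p + t *\<^sub>R q = \<rho> *\<^sub>R f"
      using f(3) e by simp
    ultimately show "s *\<^sub>R p + t *\<^sub>R q \<in> S"
      unfolding S_def using f(1) by blast
  qed
  moreover have "S \<inter> {m} = {}"
  proof -
    have "m \<notin> S"
    proof
      assume "m \<in> S"
      then obtain \<nu> d where "m = \<nu> *\<^sub>R d" "d \<in> D"
        unfolding S_def by auto
      with H2_scale_eq[OF mH, of d \<nu>] DH have "m \<in> D"
        by auto
      with mF F show False
        by auto
    qed
    thus ?thesis
      by simp
  qed
  moreover have "S \<noteq> {}"
  proof -
    obtain d where d: "d \<in> D"
      using ne by auto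
    have "1 *\<^sub>R d \<in> S"
      unfolding S_def using d zero_less_one by blast
    thus ?thesis
      by auto
  qed
  ultimately obtain a b where ab: "a \<noteq> 0" "\<forall>s\<in>S. a \<bullet> s \<le> b" "a \<bullet> m \<ge> b"
    using separating_hyperplane_sets[of S "{m}"] by auto
  \<comment> \<open>The factor \<open>\<nu>\<close> is free: large values force
    \<open>a \<bullet> d \<le> 0\<close>, and small ones
    \<open>a \<bullet> m \<ge> 0\<close>.\<close>
  have below: "\<nu> * (a \<bullet> d) \<le> a \<bullet> m" if "\<nu> > 0" "d \<in> D" for \<nu> d
  proof -
    have "\<nu> *\<^sub>R d \<in> S"
      unfolding S_def using that by auto
    with ab have "a \<bullet> (\<nu> *\<^sub>R d) \<le> a \<bullet> m"
      by fastforce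
    thus ?thesis
      by simp
  qed
  have neg: "a \<bullet> d \<le> 0" if "d \<in> D" for d
  proof (rule ccontr)
    assume "\<not> ?thesis"
    hence pos: "a \<bullet> d > 0"
      by simp
    have "(\<bar>a \<bullet> m\<bar> + 1) / (a \<bullet> d) * (a \<bullet> d) \<le> a \<bullet> m"
      using pos that by (intro below) (auto intro!: divide_pos_pos)
    thus False
      using pos by simp
  qed
  have am: "a \<bullet> m \<ge> 0"
  proof (rule ccontr)
    assume "\<not> ?thesis"
    hence m0: "a \<bullet> m < 0"
      by simp
    obtain d where d: "d \<in> D"
      using ne by auto
    have "a \<bullet> d < 0"
      using below[of 1 d] d m0 by simp
    moreover from this m0 have "(a \<bullet> m) / (2 * (a \<bullet> d)) * (a \<bullet> d) \<le> a \<bullet> m"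
      by (intro below d) (simp add: divide_neg_neg)
    ultimately show False
      using m0 by simp
  qed
  have "closure D \<subseteq> {z. a \<bullet> z \<le> 0}"
    using neg by (intro closure_minimal) (auto simp: closed_halfspace_le)
  hence negF: "a \<bullet> z \<le> 0" if "z \<in> ?F" for z
    using that Fcl by auto
  have "a \<bullet> x \<le> 0" "a \<bullet> y \<le> 0"
    using negF seg geod_segment_endpoints[OF xy(1,2)] by auto
  moreover have "a \<bullet> x + a \<bullet> y = r * (a \<bullet> m)"
    using arg_cong[OF rm(3), of "\<lambda>z. a \<bullet> z"] by (simp add: inner_add_right)
  hence "a \<bullet> x + a \<bullet> y \<ge> 0"
    using am rm(1) by simp
  ultimately have a0: "a \<bullet> x = 0" "a \<bullet> y = 0"
    by linarith+
  \<comment> \<open>Negating the third coordinate turns the Euclidean normal into the Minkowski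
    normal.\<close>
  define d :: "real^3" where "d = vector [a$1, a$2, - a$3]"
  have dz: "mink d z = a \<bullet> z" for z
    by (simp add: d_def mink_def inner_vec_def sum_3)
  obtain \<kappa> where \<kappa>: "d = \<kappa> *\<^sub>R lcross x y"
    using orthogonal_complement_pair[OF xy, of d] a0 dz by metis
  have tr: "a \<bullet> z = \<kappa> * triple x y z" for z
    unfolding dz[symmetric] \<kappa> by (simp add: mink_linear mink_lcross)
  have "\<kappa> \<noteq> 0"
    using tr[of a] ab(1) by auto
  thus ?thesis
    using negF tr by (intro that[of "-\<kappa>"]) auto
qed

text \<open>If a vertex lay on the line of another edge, the supporting lines of the two neighbouring edges
  would force it to be inside that edge, and its own two supporting lines would then contain
  that edge, so that its corner would be flat.\<close>

lemma cyclic_convex_position: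
  fixes V :: "nat \<Rightarrow> real^3"
  assumes n: "n \<ge> 3"
    and per: "\<And>i. V (i + n) = V i"
    and H: "\<And>i. V i \<in> H2"
    and inj: "\<And>i d. 0 < d \<Longrightarrow> d < n \<Longrightarrow> V i \<noteq> V (i + d)"
    and supp: "\<And>i. \<exists>c. c \<noteq> 0 \<and> (\<forall>j. 0 \<le> c * triple (V i) (V (Suc i)) (V j))"
    and corner: "\<And>i. triple (V i) (V (Suc i)) (V (Suc (Suc i))) \<noteq> 0"
  obtains \<sigma> where "\<sigma> * \<sigma> = 1"
    "\<And>i d. 2 \<le> d \<Longrightarrow> d < n \<Longrightarrow> \<sigma> * triple (V i) (V (Suc i)) (V (i + d)) > 0"
proof -
  have neS: "V i \<noteq> V (Suc i)" for i
    using inj[of 1 i] n by simp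
  \<comment> \<open>The orientation of the first corner; induction will show that all corners share
    it.\<close>
  define \<sigma> where "\<sigma> = sgn (triple (V 0) (V (Suc 0)) (V (Suc (Suc 0))))"
  have \<sigma>: "\<sigma> * \<sigma> = 1"
    using corner[of 0] by (simp add: \<sigma>_def sgn_mult_self_eq)
  define T where "T i z = \<sigma> * triple (V i) (V (Suc i)) z" for i z
  have T_ends: "T i (V i) = 0" "T i (V (Suc i)) = 0" for i
    by (simp_all add: T_def)
  have T_lin: "T i (a *\<^sub>R x + b *\<^sub>R y) = a * T i x + b * T i y" for i a b x y
    by (simp add: T_def triple_add3 triple_scale3 algebra_simps)
  \<comment> \<open>Both edges at a corner see it with the same determinant, which carries the sign
    of one edge to the next.\<close>
  have T_rot: "T (Suc i) (V i) = T i (V (Suc (Suc i)))" for i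
    by (simp add: T_def triple_rotate[of "V i"])
  \<comment> \<open>Each edge has its own constant \<open>c\<close> of unknown sign; in the product
    of two values it enters as a square.\<close>
  have T_sign: "0 \<le> T i (V j)" if "T i (V k) > 0" for i j k
  proof -
    obtain c where c: "c \<noteq> 0" "\<And>j. 0 \<le> c * triple (V i) (V (Suc i)) (V j)"
      using supp[of i] by blast
    have "0 \<le> (c * triple (V i) (V (Suc i)) (V j)) * (c * triple (V i) (V (Suc i)) (V k))"
      by (rule mult_nonneg_nonneg[OF c(2) c(2)])
    also have "\<dots> = (c * c) * (\<sigma> * \<sigma>) * (triple (V i) (V (Suc i)) (V j) * triple (V i) (V (Suc i)) (V k))"
      unfolding \<sigma> by (simp add: ac_simps)
    also have "\<dots> = (c * c) * (T i (V j) * T i (V k))"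
      by (simp add: T_def ac_simps)
    finally have "0 \<le> (c * c) * (T i (V j) * T i (V k))" .
    moreover have "c * c > 0"
      using c(1) not_real_square_gt_zero by blast
    ultimately have "0 \<le> T i (V j) * T i (V k)"
      by (metis mult_le_cancel_left_pos mult_zero_right)
    thus ?thesis
      using that by (simp add: zero_le_mult_iff)
  qed
  have T_corner: "T i (V (Suc (Suc i))) > 0" for i
  proof (induction i)
    case 0
    have "T 0 (V (Suc (Suc 0))) = \<bar>triple (V 0) (V (Suc 0)) (V (Suc (Suc 0)))\<bar>"
      by (simp add: T_def \<sigma>_def abs_sgn mult.commute)
    then show ?case
      using corner[of 0] by simp
  next
    case (Suc i)
    have "0 \<le> T (Suc i) (V (Suc (Suc (Suc i))))"
      using T_sign[of "Suc i" i] Suc T_rot[of i] by simp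
    moreover have "T (Suc i) (V (Suc (Suc (Suc i)))) \<noteq> 0"
      using corner[of "Suc i"] \<sigma> by (auto simp: T_def)
    ultimately show ?case
      by simp
  qed
  have T_nonneg: "0 \<le> T i (V j)" for i j
    by (rule T_sign[OF T_corner])
  have T_rot_pos: "T (Suc i) (V i) > 0" for i
    unfolding T_rot by (rule T_corner)
  have strict: "T (Suc i) (V (Suc j)) > 0"
    if ne: "V (Suc j) \<noteq> V (Suc i)" "V (Suc j) \<noteq> V (Suc (Suc i))" for i j
  proof (rule ccontr)
    assume "\<not> ?thesis"
    hence "T (Suc i) (V (Suc j)) = 0"
      using T_nonneg[of "Suc i" "Suc j"] by simp
    hence "triple (V (Suc i)) (V (Suc (Suc i))) (V (Suc j)) = 0"
      using \<sigma> by (auto simp: T_def)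
    then obtain a b where ab: "V (Suc j) = a *\<^sub>R V (Suc i) + b *\<^sub>R V (Suc (Suc i))"
      using coplanar_combination[OF H H neS] by metis
    \<comment> \<open>The functional of the next edge vanishes on \<open>V (Suc (Suc i))\<close> and
      so tests \<open>a\<close>; that of the previous edge vanishes on \<open>V (Suc i)\<close> and
      tests \<open>b\<close>.\<close>
    have "0 \<le> a * T (Suc (Suc i)) (V (Suc i))"
      using T_nonneg[of "Suc (Suc i)" "Suc j"] unfolding ab T_lin T_ends by simp
    hence "a \<ge> 0"
      using T_rot_pos[of "Suc i"] by (simp add: zero_le_mult_iff)
    have "0 \<le> b * T i (V (Suc (Suc i)))"
      using T_nonneg[of i "Suc j"] unfolding ab T_lin T_ends by simp
    hence "b \<ge> 0"
      using T_corner[of i] by (simp add: zero_le_mult_iff)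
    have "a \<noteq> 0"
    proof
      assume "a = 0"
      hence "V (Suc j) = V (Suc (Suc i))"
        by (intro H2_scale_eq[where r = b, OF H H]) (simp add: ab)
      with ne show False
        by simp
    qed
    have "b \<noteq> 0"
    proof
      assume "b = 0"
      hence "V (Suc j) = V (Suc i)"
        by (intro H2_scale_eq[where r = a, OF H H]) (simp add: ab)
      with ne show False
        by simp
    qed
    have pos: "a > 0" "b > 0"
      using \<open>a \<ge> 0\<close> \<open>b \<ge> 0\<close> \<open>a \<noteq> 0\<close> \<open>b \<noteq> 0\<close> by auto
    \<comment> \<open>As \<open>V (Suc j)\<close> is inside the edge, a functional that is
      nonnegative on the vertices and vanishes there also vanishes at the endpoint.\<close>
    have zero: "T k (V (Suc i)) = 0" if "T k (V (Suc j)) = 0" for k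
    proof -
      have "a * T k (V (Suc i)) + b * T k (V (Suc (Suc i))) = 0"
        using that unfolding ab T_lin .
      moreover have "0 \<le> a * T k (V (Suc i))" "0 \<le> b * T k (V (Suc (Suc i)))"
        using pos T_nonneg by auto
      ultimately have "a * T k (V (Suc i)) = 0"
        by linarith
      thus ?thesis
        using pos by simp
    qed
    \<comment> \<open>The planes of both edges at \<open>V (Suc j)\<close> thus contain
      \<open>V (Suc i)\<close>, which makes the corner there flat.\<close>
    have "triple (V j) (V (Suc j)) (V (Suc i)) = 0"
      and "triple (V (Suc j)) (V (Suc (Suc j))) (V (Suc i)) = 0"
      using zero[OF T_ends(2)[of j]] zero[OF T_ends(1)[of "Suc j"]] \<sigma> by (auto simp: T_def)
    hence "triple (V (Suc i)) (V (Suc j)) (V j) = 0"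
      and "triple (V (Suc i)) (V (Suc j)) (V (Suc (Suc j))) = 0"
      by (metis triple_rotate triple_swap minus_zero)+
    with coplanar_combination[OF H H ne(1)[symmetric]] obtain p q p' q'
      where "V j = p *\<^sub>R V (Suc i) + q *\<^sub>R V (Suc j)"
        and "V (Suc (Suc j)) = p' *\<^sub>R V (Suc i) + q' *\<^sub>R V (Suc j)"
      by metis
    moreover have "triple (p *\<^sub>R x + q *\<^sub>R y) y (p' *\<^sub>R x + q' *\<^sub>R y) = 0" for x y
      by (simp add: triple_def algebra_simps)
    ultimately have "triple (V j) (V (Suc j)) (V (Suc (Suc j))) = 0"
      by metis
    with corner show False
      by blast
  qed
  show ?thesis
  proof (rule that[OF \<sigma>])
    fix i d :: nat
    assume d: "2 \<le> d" "d < n"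
    \<comment> \<open>The cyclic predecessor of \<open>i\<close>; adding \<open>n\<close> avoids
      truncated subtraction.\<close>
    define i' where "i' = i + n - 1"
    have i': "Suc i' = i + n"
      using n by (simp add: i'_def)
    have V: "V (Suc i') = V i" "V (Suc (Suc i')) = V (Suc i)" "V (Suc (i' + d)) = V (i + d)"
      using per[of i] per[of "Suc i"] per[of "i + d"] i' by (metis add_Suc add.commute add.left_commute)+
    have "V (i + d) \<noteq> V i" "V (i + d) \<noteq> V (Suc i)"
    proof -
      have "0 < d" "0 < d - 1" "d - 1 < n" "Suc i + (d - 1) = i + d"
        using d by simp_all
      thus "V (i + d) \<noteq> V i" "V (i + d) \<noteq> V (Suc i)"
        using inj[of d i] inj[of "d - 1" "Suc i"] d(2) by metis+
    qed
    with strict[of "i' + d" i'] show "\<sigma> * triple (V i) (V (Suc i)) (V (i + d)) > 0"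
      unfolding V T_def by simp
  qed
qed

section \<open>Positivity of the invariant\<close>

lemma sum_periodic_shift:
  fixes f :: "nat \<Rightarrow> 'a::comm_monoid_add"
  assumes "\<And>i. f (i + n) = f i"
  shows "(\<Sum>i<n. f (k + i)) = (\<Sum>i<n. f i)"
proof (induction k)
  case (Suc k)
  show ?case
  proof (cases n)
    case (Suc m)
    have "(\<Sum>i<n. f (Suc k + i)) = (\<Sum>i<m. f (k + Suc i)) + f (k + n)"
      by (simp add: Suc)
    also have "\<dots> = (\<Sum>i<n. f (k + i))"
      using assms[of k] sum.lessThan_Suc_shift[of "\<lambda>i. f (k + i)" m]
      by (simp add: Suc add.commute)
    finally show ?thesis
      by (simp add: Suc.IH)
  qed simp
qed simp

theorem mainTheorem5:
  fixes n :: nat and v v' :: "nat \<Rightarrow> real^3"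
  assumes "convex_polygon n v"
    and "isometric_deformation n v v'"
    and "\<not> trivial_deformation n v v'"
  shows "quadratic_invariant n v v' \<in> dual_interior_cone n v"
proof -
  \<comment> \<open>Periodic extension to all indices, so that cyclic neighbours become
    successors.\<close>
  define V where "V i = v (i mod n)" for i
  define V' where "V' i = v' (i mod n)" for i
  define a where "a i = d_angle n v v' (i mod n)" for i
  have n: "n \<ge> 3"
    using assms(1) by (simp add: convex_polygon_def hyp_polygon_def)
  hence ltn: "i mod n < n" for i
    by simp
  have nxt: "next_idx n (i mod n) = Suc i mod n" for i
    by (simp add: next_idx_def mod_Suc_eq)
  have prv: "prev_idx n (Suc i mod n) = i mod n" for i
  proof -
    have "(Suc i mod n + n - 1) mod n = (Suc i mod n + (n - 1)) mod n"
      using n by simp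
    also have "\<dots> = (Suc i + (n - 1)) mod n"
      by (rule mod_add_left_eq)
    also have "Suc i + (n - 1) = i + n"
      using n by simp
    finally show ?thesis
      by (simp add: prev_idx_def)
  qed
  have per: "V (i + n) = V i" "V' (i + n) = V' i" "a (i + n) = a i" for i
    by (simp_all add: V_def V'_def a_def)
  have H: "V i \<in> H2" for i
    using assms(1) ltn by (auto simp: convex_polygon_def hyp_polygon_def V_def)
  have injv: "inj_on v {..<n}"
    using assms(1) by (simp add: convex_polygon_def simple_polygon_def)
  have inj: "V i \<noteq> V (i + d)" if "0 < d" "d < n" for i d
  proof
    assume "V i = V (i + d)"
    hence "(i + d) mod n = i mod n"
      using injv ltn by (simp add: V_def inj_on_def)
    hence "n dvd d"
      using mod_eq_dvd_iff_nat[of i "i + d" n] by simp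
    thus False
      using that by (simp add: nat_dvd_not_less)
  qed
  have neS: "V i \<noteq> V (Suc i)" for i
    using inj[of 1 i] n by simp
  have tang: "V' i \<in> tangent_H2 (V i)" for i
    using assms(2) ltn by (simp add: isometric_deformation_def first_order_deformation_def V_def V'_def)
  have iso: "mink (V' i) (V (Suc i)) + mink (V i) (V' (Suc i)) = 0" for i
    using assms(2) ltn[of i] nxt[of i] by (auto simp: isometric_deformation_def V_def V'_def)
  have angle: "interior_angle n u (Suc i mod n)
      = hyp_angle (u (i mod n)) (u (Suc i mod n)) (u (Suc (Suc i) mod n))" for u i
    unfolding interior_angle_def prv nxt ..
  have ang: "0 < hyp_angle (V i) (V (Suc i)) (V (Suc (Suc i)))"
    "hyp_angle (V i) (V (Suc i)) (V (Suc (Suc i))) < pi" for i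
    using assms(1) ltn[of "Suc i"] unfolding V_def angle[symmetric] convex_polygon_def by auto
  note deriv = hyp_angle_derivative[OF H H H tang tang tang neS neS iso iso ang]
  have a: "a (Suc i) = - (mink (V' i) (V (Suc (Suc i))) + mink (V i) (V' (Suc (Suc i))))
      / \<bar>triple (V i) (V (Suc i)) (V (Suc (Suc i)))\<bar>" for i
    unfolding a_def d_angle_def angle V_def[symmetric] V'_def[symmetric] by (rule deriv)
  obtain D where D: "convex_domain_H2 D"
    "top_of_set H2 frontier_of D = (\<Union>i<n. edge n v i)"
    using assms(1) by (auto simp: convex_polygon_def)
  have seg: "geod_segment (V i) (V (Suc i)) \<subseteq> top_of_set H2 frontier_of D" for i
  proof -
    have "geod_segment (V i) (V (Suc i)) = edge n v (i mod n)"
      by (simp add: edge_def nxt V_def)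
    thus ?thesis
      unfolding D using ltn by blast
  qed
  have "V i \<in> geod_segment (V i) (V (Suc i))" for i
    by (rule geod_segment_endpoints(1)[OF H H])
  hence bdry: "V i \<in> top_of_set H2 frontier_of D" for i
    using seg by blast
  have supp: "\<exists>c. c \<noteq> 0 \<and> (\<forall>j. 0 \<le> c * triple (V i) (V (Suc i)) (V j))" for i
    using boundary_segment_supporting[OF D(1) H H neS seg, of i] bdry by metis
  obtain \<sigma> where \<sigma>: "\<sigma> * \<sigma> = 1"
    and cyc: "\<And>i d. 2 \<le> d \<Longrightarrow> d < n \<Longrightarrow> \<sigma> * triple (V i) (V (Suc i)) (V (i + d)) > 0"
    using cyclic_convex_position[OF n per(1) H inj supp deriv(1)] by metis
  \<comment> \<open>The choice depends only on the data at \<open>i\<close> and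
    \<open>Suc i\<close>, so \<open>K\<close> is periodic like \<open>V\<close> and
    \<open>V'\<close>.\<close>
  define K where "K i = (SOME K. lcross K (V i) = V' i \<and> lcross K (V (Suc i)) = V' (Suc i))" for i
  have K: "lcross (K i) (V i) = V' i" "lcross (K i) (V (Suc i)) = V' (Suc i)" for i
  proof -
    have "\<exists>K. lcross K (V i) = V' i \<and> lcross K (V (Suc i)) = V' (Suc i)"
      using edge_killing_field[OF H H neS, of "V' i" i "V' (Suc i)"] tang[of i] tang[of "Suc i"] iso[of i]
      unfolding tangent_H2_def by blast
    from someI_ex[OF this] show "lcross (K i) (V i) = V' i" "lcross (K i) (V (Suc i)) = V' (Suc i)"
      by (simp_all add: K_def)
  qed
  have perK: "K (i + n) = K i" for i
    using per(1,2)[of i] per(1,2)[of "Suc i"] by (simp add: K_def)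
  have step: "K (Suc i) = K i - (\<sigma> * a (Suc i)) *\<^sub>R V (Suc i)" for i
  proof -
    let ?t = "triple (V i) (V (Suc i)) (V (Suc (Suc i)))"
    \<comment> \<open>Both fields give \<open>V (Suc i)\<close> the same velocity, so they differ by
      a multiple of it; the variation of the diagonal from \<open>V i\<close> to
      \<open>V (Suc (Suc i))\<close> then determines the factor.\<close>
    have "lcross (K (Suc i) - K i) (V (Suc i)) = 0"
      by (simp add: lcross_diff_left K)
    moreover have "mink (V (Suc i)) (V (Suc i)) = -1"
      using H by (simp add: H2_def)
    ultimately obtain \<kappa> where \<kappa>: "K (Suc i) - K i = \<kappa> *\<^sub>R V (Suc i)"
      using parallel_if_lcross_zero by blast
    have "mink (V' i) (V (Suc (Suc i))) + mink (V i) (V' (Suc (Suc i)))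
        = triple (K i) (V i) (V (Suc (Suc i))) + triple (K (Suc i)) (V (Suc (Suc i))) (V i)"
      unfolding K(1)[of i, symmetric] K(2)[of "Suc i", symmetric] mink_lcross mink_lcross_right ..
    also have "\<dots> = - triple (K (Suc i) - K i) (V i) (V (Suc (Suc i)))"
      by (simp add: triple_def algebra_simps)
    also have "\<dots> = \<kappa> * ?t"
      unfolding \<kappa> by (simp add: triple_def algebra_simps)
    finally have "a (Suc i) = - (\<kappa> * ?t) / \<bar>?t\<bar>"
      unfolding a by simp
    moreover have pos: "\<sigma> * ?t > 0"
      using cyc[of 2 i] n by simp
    have "\<sigma> = 1 \<or> \<sigma> = -1"
      using \<sigma> square_eq_1_iff by blast
    with pos have "\<bar>?t\<bar> = \<sigma> * ?t" and "?t \<noteq> 0"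
      by auto
    ultimately have "\<sigma> * a (Suc i) = - \<kappa>"
      using \<open>\<sigma> = 1 \<or> \<sigma> = -1\<close> by auto
    with \<kappa> show ?thesis
      by (simp add: algebra_simps)
  qed
  have "mink (quadratic_invariant n v v') (v k) > 0" if k: "k < n" for k
  proof -
    \<comment> \<open>The coefficients are \<open>\<sigma> * a\<close>, so \<open>\<sigma>\<close>
      enters each term twice and cancels below.\<close>
    have "0 < (\<Sum>i<n. (\<sigma> * a (k + i)) * (\<sigma> * triple (K (k + i)) (V (k + i)) (V (k + 0))))"
    proof (rule quadratic_sum_pos[OF n _ _ _ \<sigma>])
      show "K (k + Suc i) = K (k + i) - (\<sigma> * a (k + Suc i)) *\<^sub>R V (k + Suc i)" for i
        using step[of "k + i"] by simp
      show "K (k + n) = K (k + 0)" "V (k + n) = V (k + 0)"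
        by (simp_all add: per perK)
      show "0 < \<sigma> * triple (V (k + 0)) (V (k + 1)) (V (k + j))" if "2 \<le> j" "j < n" for j
        using cyc[of j k] that by simp
      show "0 < \<sigma> * triple (V (k + 0)) (V (k + j)) (V (k + (n - 1)))" if "1 \<le> j" "j < n - 1" for j
      proof -
        \<comment> \<open>Here the edge ending at \<open>V k\<close> is viewed from
          \<open>V (k + j)\<close>.\<close>
        have "Suc (k + (n - 1)) = k + n" "k + (n - 1) + Suc j = (k + j) + n"
          using n by simp_all
        hence "V (Suc (k + (n - 1))) = V k" "V (k + (n - 1) + Suc j) = V (k + j)"
          using per(1) by metis+
        with cyc[of "Suc j" "k + (n - 1)"] that
        have "0 < \<sigma> * triple (V (k + (n - 1))) (V k) (V (k + j))"
          by (simp add: per(1))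
        thus ?thesis
          by (simp add: triple_rotate[of "V (k + (n - Suc 0))"])
      qed
      show "0 < \<sigma> * triple (V (k + 0)) (V (k + j)) (V (k + Suc j))" if "1 \<le> j" "j < n - 1" for j
      proof -
        \<comment> \<open>Here the edge starting at \<open>V (k + j)\<close> is viewed from
          \<open>V k\<close>, which is \<open>n - j\<close> steps ahead.\<close>
        have "k + j + (n - j) = k + n"
          using that by simp
        hence "V (k + j + (n - j)) = V k"
          using per(1) by metis
        with cyc[of "n - j" "k + j"] that
        have "0 < \<sigma> * triple (V (k + j)) (V (k + Suc j)) (V k)"
          by simp
        thus ?thesis
          by (simp add: triple_rotate[of "V k"])
      qed
      \<comment> \<open>If all edges moved by one Killing field, the deformation would be
        trivial.\<close>
      have "\<exists>i<n. K (k + i) \<noteq> K k"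
      proof (rule ccontr)
        assume const: "\<not> ?thesis"
        have "v' i = lcross (K k) (v i)" if "i < n" for i
        proof -
          have "K i = K k"
          proof (cases "i \<ge> k")
            case True
            with const that show ?thesis
              by (metis le_add_diff_inverse less_imp_diff_less)
          next
            case False
            hence "i + n = k + (i + n - k)" "i + n - k < n"
              using k by simp_all
            with const perK[of i] show ?thesis
              by metis
          qed
          with K(1)[of i] that show ?thesis
            by (simp add: V_def V'_def)
        qed
        with assms(3) killing_deformation_trivial show False
          by blast
      qed
      then obtain i0 where "i0 < n" "K (k + i0) \<noteq> K k"
        by blast
      thus "(SOME i. i < n \<and> K (k + i) \<noteq> K k) < n"
        "K (k + (SOME i. i < n \<and> K (k + i) \<noteq> K k)) \<noteq> K (k + 0)"
        using someI[of "\<lambda>i. i < n \<and> K (k + i) \<noteq> K k" i0] by auto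
    qed
    also have "\<dots> = (\<Sum>i<n. a (k + i) * mink (V' (k + i)) (V k))"
    proof (intro sum.cong refl)
      fix i
      have "(\<sigma> * a (k + i)) * (\<sigma> * triple (K (k + i)) (V (k + i)) (V (k + 0)))
          = (\<sigma> * \<sigma>) * (a (k + i) * triple (K (k + i)) (V (k + i)) (V k))"
        by (simp add: ac_simps)
      thus "(\<sigma> * a (k + i)) * (\<sigma> * triple (K (k + i)) (V (k + i)) (V (k + 0)))
          = a (k + i) * mink (V' (k + i)) (V k)"
        unfolding \<sigma> K(1)[symmetric] mink_lcross by simp
    qed
    also have "\<dots> = (\<Sum>i<n. a i * mink (V' i) (V k))"
      by (rule sum_periodic_shift[where f="\<lambda>i. a i * mink (V' i) (V k)"]) (simp add: per)
    also have "\<dots> = mink (quadratic_invariant n v v') (v k)"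
      using k by (simp add: quadratic_invariant_def mink_sum_left mink_linear a_def V_def V'_def)
    finally show ?thesis .
  qed
  thus ?thesis
    by (simp add: dual_interior_cone_def)
qed

end
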